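(* Let $p$ be a prime, let $s\in\mathbb N$, let $m_1,\ldots,m_s$ be positive integers, and let $k_1,\ldots,k_s,n_1,\ldots,n_s$ be nonnegative integers with $k_i\leq n_i$ for all $i$. Write $K=k_1m_1+\cdots+k_sm_s$ and $D=n_1m_1+\cdots+n_sm_s-K$. Then $$\int_{\mathbb Z_p}B_{k_1,n_1}^{m_1}(x)B_{k_2,n_2}^{m_2}(x)\cdots B_{k_s,n_s}^{m_s}(x)\,d\mu_1(x)=\binom{n_1}{k_1}^{m_1}\binom{n_2}{k_2}^{m_2}\cdots\binom{n_s}{k_s}^{m_s}\sum_{l=0}^{D}(-1)^{l}\binom{D}{l}B_{K+l}.$$
   Context: For integers $0\leq k\leq n$, the Bernstein polynomial is $B_{k,n}(x)=\binom{n}{k}x^k(1-x)^{n-k}$, and $B_{k,n}^{m}(x)$ denotes the $m$-fold product $B_{k,n}(x)\cdots B_{k,n}(x)$. $\mathbb Z_p$ denotes the ring of $p$-adic integers, and for a uniformly differentiable $f:\mathbb Z_p\to\mathbb C_p$ the bosonic $p$-adic (Volkenborn) integral is $\int_{\mathbb Z_p}f(x)\,d\mu_1(x)=\lim_{N\to\infty}\frac{1}{p^N}\sum_{x=0}^{p^N-1}f(x)$. $B_m$ denotes the $m$-th Bernoulli number, defined by $\frac{t}{e^t-1}=\sum_{m\geq0}B_m\frac{t^m}{m!}$; one has $\int_{\mathbb Z_p}x^m\,d\mu_1(x)=B_m$. *)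

theory Defs
  imports
    "HOL-Analysis.Analysis"
    "HOL-Computational_Algebra.Computational_Algebra"
begin

definition bernstein :: "nat \<Rightarrow> nat \<Rightarrow> 'a::comm_ring_1 \<Rightarrow> 'a" where
  "bernstein k n x = of_nat (n choose k) * x ^ k * (1 - x) ^ (n - k)"

definition bernoulli :: "nat \<Rightarrow> rat" where
  "bernoulli m = fact m * fps_nth (fps_X / (fps_exp 1 - 1)) m"

lemma bernoulli_egf: "Abs_fps (\<lambda>m. bernoulli m / fact m) * (fps_exp 1 - 1) = fps_X"
proof -
  have nz: "fps_nth (fps_exp (1::rat) - 1) 1 \<noteq> 0" by simp
  have sub: "subdegree (fps_exp (1::rat) - 1) = 1"
    using nz by (intro subdegreeI) auto
  then have "fps_exp (1::rat) - 1 dvd fps_X"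
    by (subst fps_dvd_iff) auto
  moreover have "Abs_fps (\<lambda>m. bernoulli m / fact m) = fps_X / (fps_exp 1 - 1)"
    by (simp add: fps_eq_iff bernoulli_def)
  ultimately show ?thesis
    by simp
qed

locale nonarch_valued_field =
  fixes absv :: "'a::field_char_0 \<Rightarrow> real"
  assumes absv_nonneg: "0 \<le> absv x"
    and absv_eq_0_iff: "absv x = 0 \<longleftrightarrow> x = 0"
    and absv_mult: "absv (x * y) = absv x * absv y"
    and absv_ultrametric: "absv (x + y) \<le> max (absv x) (absv y)"
begin

lemma absv_minus: "absv (- x) = absv x"
proof -
  have "absv (- 1) * absv (- 1) = absv 1 * absv 1"
    by (metis absv_mult minus_mult_minus)
  then have "absv (- 1) = absv 1"
    using absv_nonneg[of "- 1"] absv_nonneg[of 1] by (metis abs_of_nonneg real_sqrt_mult_self real_sqrt_mult)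
  then show ?thesis
    by (metis absv_mult mult_1 mult_minus1)
qed

sublocale Metric_space UNIV "\<lambda>x y. absv (x - y)"
proof
  fix x y z :: 'a
  show "absv (x - y) = absv (y - x)"
    by (metis absv_minus minus_diff_eq)
  have "absv (x - z) \<le> max (absv (x - y)) (absv (y - z))"
    using absv_ultrametric[of "x - y" "y - z"] by simp
  then show "absv (x - z) \<le> absv (x - y) + absv (y - z)"
    using absv_nonneg[of "x - y"] absv_nonneg[of "y - z"] by linarith
qed (auto simp: absv_nonneg absv_eq_0_iff)

end

text \<open>
  The normalisation \<open>\<bar>p\<bar> = 1 / p\<close> makes \<open>absv\<close> restrict to the \<open>p\<close>-adic absolute
  value on \<open>\<rat>\<close>. By completeness of the ambient field, the closure \<open>Qp\<close> of \<open>\<rat>\<close> is the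
  completion of \<open>\<rat>\<close> for that absolute value.
\<close>

locale complete_padic_field = nonarch_valued_field absv
  for absv :: "'a::field_char_0 \<Rightarrow> real" +
  fixes p :: nat
  assumes prime_p: "prime p"
    and absv_p: "absv (of_nat p) = 1 / real p"
    and complete: mcomplete
begin

definition Qp :: "'a set" where
  "Qp = mtopology closure_of \<rat>"

definition Zp :: "'a set" where
  "Zp = {x \<in> Qp. absv x \<le> 1}"

definition Qp_alg :: "'a set" where
  "Qp_alg = {x. \<exists>q. q \<noteq> 0 \<and> (\<forall>i. coeff q i \<in> Qp) \<and> poly q x = 0}"

text \<open>Uniform (strict) differentiability on \<open>Zp\<close>: the difference quotient
  \<open>(f x - f y) / (x - y)\<close> has a limit as \<open>(x, y)\<close> tends to \<open>(a, a)\<close>, for every \<open>a\<close>.\<close>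

definition uniformly_differentiable :: "('a \<Rightarrow> 'a) \<Rightarrow> bool" where
  "uniformly_differentiable f \<longleftrightarrow>
    (\<forall>a\<in>Zp. \<exists>l. \<forall>\<epsilon>>0. \<exists>\<delta>>0. \<forall>x\<in>Zp. \<forall>y\<in>Zp.
      x \<noteq> y \<and> absv (x - a) < \<delta> \<and> absv (y - a) < \<delta> \<longrightarrow>
        absv ((f x - f y) / (x - y) - l) < \<epsilon>)"

definition has_volkenborn_integral :: "('a \<Rightarrow> 'a) \<Rightarrow> 'a \<Rightarrow> bool" where
  "has_volkenborn_integral f I \<longleftrightarrow>
    uniformly_differentiable f \<and>
    limitin mtopology (\<lambda>N. 1 / of_nat (p ^ N) * (\<Sum>x<p ^ N. f (of_nat x))) I sequentially"

definition volkenborn_integrable :: "('a \<Rightarrow> 'a) \<Rightarrow> bool" where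
  "volkenborn_integrable f \<longleftrightarrow> (\<exists>I. has_volkenborn_integral f I)"

definition volkenborn_integral :: "('a \<Rightarrow> 'a) \<Rightarrow> 'a" where
  "volkenborn_integral f = (THE I. has_volkenborn_integral f I)"

lemma has_volkenborn_integral_unique:
  assumes "has_volkenborn_integral f I" "has_volkenborn_integral f J"
  shows "I = J"
  using assms limitin_metric_unique[OF _ _ trivial_limit_sequentially]
  unfolding has_volkenborn_integral_def by blast

lemma volkenborn_integral_eq:
  assumes "has_volkenborn_integral f I"
  shows "volkenborn_integral f = I"
  unfolding volkenborn_integral_def
  using assms has_volkenborn_integral_unique by blast

end

text \<open>
  \<open>\<complex>\<^sub>p\<close>, the completion of an algebraic closure of \<open>\<rat>\<^sub>p\<close>: a complete field in which the
  elements algebraic over \<open>\<rat>\<^sub>p\<close> are dense and form an algebraically closed field. Together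
  with the normalisation of the absolute value, this determines the field up to
  isometric isomorphism.
\<close>

locale padic_complex_field = complete_padic_field absv p
  for absv :: "'a::field_char_0 \<Rightarrow> real" and p :: nat +
  assumes Qp_alg_closed:
      "(\<And>i. coeff q i \<in> Qp_alg) \<Longrightarrow> degree q > 0 \<Longrightarrow> \<exists>x\<in>Qp_alg. poly q x = 0"
    and Qp_alg_dense: "mtopology closure_of Qp_alg = UNIV"

end

theory Submission
  imports Defs
begin

text \<open>
  By Faulhaber's formula, the Riemann sum \<open>(1/M) \<Sum>x<M. x^m\<close> is itself a polynomial in \<open>M\<close>
  with constant term \<open>B\<^sub>m\<close>; since \<open>p^N\<close> tends to \<open>0\<close> \<open>p\<close>-adically,
  the Volkenborn integral of \<open>x^m\<close> is \<open>B\<^sub>m\<close>. The product of Bernstein polynomials is a constant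
  times \<open>x^K (1 - x)^D\<close>, which the binomial theorem turns into a combination of powers.
\<close>

section \<open>Power sums and Bernoulli numbers via generating functions\<close>

lemma sum_fps_exp_telescope:
  "(\<Sum>x<M. fps_exp (of_nat x)) * (fps_exp 1 - 1) = fps_exp (of_nat M :: rat) - 1"
proof (induction M)
  case (Suc M)
  have "fps_exp (of_nat (Suc M) :: rat) = fps_exp (of_nat M) * fps_exp 1"
    by (simp add: fps_exp_add_mult[symmetric] add.commute)
  then show ?case
    using Suc by (simp add: algebra_simps)
qed simp

text \<open>Compare coefficients of \<open>fps_X ^ Suc m\<close> in the generating function of the
  power sums, a geometric sum of exponentials. A factor \<open>of_nat M\<close> is kept in front, so
  that dividing by M leaves a polynomial.\<close>

lemma faulhaber:
  "(\<Sum>x<M. of_nat x ^ m :: rat) = of_nat M *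
    (\<Sum>j\<le>m. fact m / (fact j * fact (Suc m - j)) * bernoulli j * of_nat M ^ (m - j))"
proof -
  let ?B = "Abs_fps (\<lambda>m. bernoulli m / fact m)"
  let ?S = "\<Sum>x<M. fps_exp (of_nat x :: rat)"
  \<comment> \<open>\<open>fps_exp 1 - 1\<close> has constant term 0 and is no unit; writing
    \<open>fps_X\<close> as its product with \<open>?B\<close> replaces a division.\<close>
  have "?S * fps_X = ?S * (fps_exp 1 - 1) * ?B"
    using bernoulli_egf by (simp add: mult.assoc mult.commute)
  then have eq: "?S * fps_X = ?B * (fps_exp (of_nat M) - 1)"
    unfolding sum_fps_exp_telescope by (simp only: mult.commute)
  have "fps_nth (?S * fps_X) (Suc m) = (\<Sum>x<M. of_nat x ^ m) / fact m"
    by (simp add: fps_sum_nth sum_divide_distrib)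
  \<comment> \<open>The index j = \<open>Suc m\<close> drops out because
    \<open>fps_exp (of_nat M) - 1\<close> has constant term 0.\<close>
  moreover have "fps_nth (?B * (fps_exp (of_nat M) - 1)) (Suc m)
      = (\<Sum>j\<le>m. bernoulli j / fact j * (of_nat M ^ (Suc m - j) / fact (Suc m - j)))"
    by (simp add: fps_mult_nth atLeast0AtMost Suc_diff_le)
      (simp only: mult_ac)
  ultimately have "(\<Sum>x<M. of_nat x ^ m) / fact m
      = (\<Sum>j\<le>m. bernoulli j / fact j * (of_nat M ^ (Suc m - j) / fact (Suc m - j)))"
    using eq by simp
  then have "(\<Sum>x<M. of_nat x ^ m)
      = fact m * (\<Sum>j\<le>m. bernoulli j / fact j * (of_nat M ^ (Suc m - j) / fact (Suc m - j)))"
    by (simp add: field_simps)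
  also have "\<dots> = of_nat M *
    (\<Sum>j\<le>m. fact m / (fact j * fact (Suc m - j)) * bernoulli j * of_nat M ^ (m - j))"
    unfolding sum_distrib_left by (rule sum.cong) (auto simp: Suc_diff_le)
  finally show ?thesis .
qed

lemma sum_powers_polynomial:
  obtains q :: "'a::field_char_0 poly"
  where "poly q 0 = of_rat (bernoulli m)"
    and "\<And>M. (\<Sum>x<M. of_nat x ^ m) = of_nat M * poly q (of_nat M)"
proof
  define c where "c j = fact m / (fact j * fact (Suc m - j)) * bernoulli j" for j
  let ?q = "\<Sum>j\<le>m. monom (of_rat (c j) :: 'a) (m - j)"
  \<comment> \<open>At 0 only the monomial of exponent 0 survives, that is j = m, and there the
    factorials in \<open>c m\<close> cancel to 1.\<close>
  have "poly ?q 0 = (\<Sum>j\<le>m. if j = m then of_rat (c j) else 0)"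
    unfolding poly_sum poly_monom by (rule sum.cong) auto
  then show "poly ?q 0 = of_rat (bernoulli m)"
    by (simp add: c_def)
  show "(\<Sum>x<M. of_nat x ^ m) = of_nat M * poly ?q (of_nat M)" for M
  proof -
    have "(\<Sum>x<M. of_nat x ^ m) = (of_rat (\<Sum>x<M. of_nat x ^ m) :: 'a)"
      by (simp add: of_rat_sum of_rat_power)
    also have "\<dots> = of_nat M * poly ?q (of_nat M)"
      unfolding faulhaber c_def[symmetric]
      by (simp add: of_rat_mult of_rat_sum of_rat_power poly_sum poly_monom)
    finally show ?thesis .
  qed
qed

section \<open>Estimates for polynomials on the unit ball\<close>

context nonarch_valued_field
begin

lemma absv_0 [simp]: "absv 0 = 0"
  by (simp add: absv_eq_0_iff)

lemma absv_1 [simp]: "absv 1 = 1"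
  using absv_mult[of 1 1] absv_eq_0_iff[of 1] by simp

lemma absv_power: "absv (x ^ n) = absv x ^ n"
  by (induction n) (simp_all add: absv_mult)

lemma absv_triangle: "absv (x + y) \<le> absv x + absv y"
  using absv_ultrametric[of x y] absv_nonneg[of x] absv_nonneg[of y] by linarith

lemma absv_mult_le: "absv x \<le> a \<Longrightarrow> absv y \<le> b \<Longrightarrow> absv (x * y) \<le> a * b"
  unfolding absv_mult by (meson absv_nonneg mult_mono order_trans)

lemma poly_bounded_unit_ball:
  obtains C where "0 \<le> C" and "\<And>x. absv x \<le> 1 \<Longrightarrow> absv (poly q x) \<le> C"
proof -
  have "\<exists>C\<ge>0. \<forall>x. absv x \<le> 1 \<longrightarrow> absv (poly q x) \<le> C"
  proof (induction q)
    case 0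
    then show ?case by auto
  next
    case (pCons a q)
    then obtain C where C: "C \<ge> 0" "\<And>x. absv x \<le> 1 \<Longrightarrow> absv (poly q x) \<le> C" by blast
    have "absv (poly (pCons a q) x) \<le> absv a + C" if "absv x \<le> 1" for x
      using absv_triangle[of a "x * poly q x"] absv_mult_le[OF that C(2)[OF that]] by simp
    then show ?case
      using C(1) absv_nonneg[of a] by (intro exI[of _ "absv a + C"]) auto
  qed
  then show thesis using that by blast
qed

text \<open>Induction along Horner's scheme: the increment of X q splits by the product rule into a
  term controlled by a bound for q and one controlled by the Lipschitz constant of q.\<close>

lemma poly_lipschitz_unit_ball:
  obtains C where "0 \<le> C"
    and "\<And>x y. absv x \<le> 1 \<Longrightarrow> absv y \<le> 1 \<Longrightarrow> absv (poly q x - poly q y) \<le> C * absv (x - y)"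
proof -
  have "\<exists>C\<ge>0. \<forall>x y. absv x \<le> 1 \<longrightarrow> absv y \<le> 1 \<longrightarrow> absv (poly q x - poly q y) \<le> C * absv (x - y)"
  proof (induction q)
    case 0
    then show ?case by auto
  next
    case (pCons a q)
    then obtain C where C: "C \<ge> 0"
      "\<And>x y. absv x \<le> 1 \<Longrightarrow> absv y \<le> 1 \<Longrightarrow> absv (poly q x - poly q y) \<le> C * absv (x - y)" by blast
    obtain B where B: "B \<ge> 0" "\<And>x. absv x \<le> 1 \<Longrightarrow> absv (poly q x) \<le> B"
      using poly_bounded_unit_ball by blast
    have "absv (poly (pCons a q) x - poly (pCons a q) y) \<le> (B + C) * absv (x - y)"
      if x: "absv x \<le> 1" and y: "absv y \<le> 1" for x y
    proof -
      have eq: "poly (pCons a q) x - poly (pCons a q) y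
          = (x - y) * poly q x + y * (poly q x - poly q y)"
        by (simp add: algebra_simps)
      show ?thesis
        unfolding eq
        using absv_triangle[of "(x - y) * poly q x" "y * (poly q x - poly q y)"]
          absv_mult_le[OF order_refl B(2)[OF x], of "x - y"] absv_mult_le[OF y C(2)[OF x y]]
        by (simp add: algebra_simps)
    qed
    then show ?case
      using B(1) C(1) by (intro exI[of _ "B + C"]) auto
  qed
  then show thesis using that by blast
qed

text \<open>Strict differentiability in quantitative form, with one constant for all centres a;
  multiplying through by x - y keeps the induction free of division.\<close>

lemma poly_strict_derivative_unit_ball:
  obtains C where "0 \<le> C"
    and "\<And>x y a. absv x \<le> 1 \<Longrightarrow> absv y \<le> 1 \<Longrightarrow> absv a \<le> 1 \<Longrightarrow>
      absv (poly q x - poly q y - (x - y) * poly (pderiv q) a)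
        \<le> C * (absv (x - y) * (absv (x - a) + absv (y - a)))"
proof -
  have "\<exists>C\<ge>0. \<forall>x y a. absv x \<le> 1 \<longrightarrow> absv y \<le> 1 \<longrightarrow> absv a \<le> 1 \<longrightarrow>
      absv (poly q x - poly q y - (x - y) * poly (pderiv q) a)
        \<le> C * (absv (x - y) * (absv (x - a) + absv (y - a)))"
  proof (induction q)
    case 0
    then show ?case by auto
  next
    case (pCons c q)
    then obtain C where C: "C \<ge> 0"
      "\<And>x y a. absv x \<le> 1 \<Longrightarrow> absv y \<le> 1 \<Longrightarrow> absv a \<le> 1 \<Longrightarrow>
        absv (poly q x - poly q y - (x - y) * poly (pderiv q) a)
          \<le> C * (absv (x - y) * (absv (x - a) + absv (y - a)))" by blast
    obtain L where L: "L \<ge> 0"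
      "\<And>x y. absv x \<le> 1 \<Longrightarrow> absv y \<le> 1 \<Longrightarrow> absv (poly q x - poly q y) \<le> L * absv (x - y)"
      using poly_lipschitz_unit_ball by blast
    obtain B where B: "B \<ge> 0" "\<And>x. absv x \<le> 1 \<Longrightarrow> absv (poly (pderiv q) x) \<le> B"
      using poly_bounded_unit_ball by blast
    have "absv (poly (pCons c q) x - poly (pCons c q) y - (x - y) * poly (pderiv (pCons c q)) a)
        \<le> (L + C + B) * (absv (x - y) * (absv (x - a) + absv (y - a)))"
      if x: "absv x \<le> 1" and y: "absv y \<le> 1" and a: "absv a \<le> 1" for x y a
    proof -
      let ?u = "absv (x - y)" and ?v = "absv (x - a)" and ?w = "absv (y - a)"
      \<comment> \<open>Since (c + X q)' = q + X q', the error splits into three terms: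
        \<open>t1\<close> is small by the Lipschitz bound, \<open>t2\<close> by the induction
        hypothesis, and \<open>t3\<close> by a bound for q'.\<close>
      define t1 where "t1 = (x - y) * (poly q x - poly q a)"
      define t2 where "t2 = y * (poly q x - poly q y - (x - y) * poly (pderiv q) a)"
      define t3 where "t3 = (x - y) * ((y - a) * poly (pderiv q) a)"
      have eq: "poly (pCons c q) x - poly (pCons c q) y - (x - y) * poly (pderiv (pCons c q)) a
          = t1 + t2 + t3"
        by (simp add: pderiv_pCons t1_def t2_def t3_def algebra_simps)
      have nn: "0 \<le> ?u" "0 \<le> ?v" "0 \<le> ?w"
        by (simp_all add: absv_nonneg)
      have "absv t1 \<le> ?u * (L * ?v)"
        unfolding t1_def by (intro absv_mult_le L order_refl x a)
      also have "\<dots> \<le> L * (?u * (?v + ?w))"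
        using nn L(1) by (simp add: algebra_simps)
      finally have 1: "absv t1 \<le> L * (?u * (?v + ?w))" .
      have 2: "absv t2 \<le> C * (?u * (?v + ?w))"
        unfolding t2_def using absv_mult_le[OF y C(2)[OF x y a]] by simp
      have "absv t3 \<le> ?u * (?w * B)"
        unfolding t3_def by (intro absv_mult_le B order_refl a)
      also have "\<dots> \<le> B * (?u * (?v + ?w))"
        using nn B(1) by (simp add: algebra_simps)
      finally have 3: "absv t3 \<le> B * (?u * (?v + ?w))" .
      show ?thesis
        unfolding eq distrib_right
        using 1 2 3 absv_triangle[of "t1 + t2" t3] absv_triangle[of t1 t2] by linarith
    qed
    then show ?case
      using B(1) C(1) L(1) by (intro exI[of _ "L + C + B"]) auto
  qed
  then show thesis using that by blast
qed

end

section \<open>Volkenborn integrals of polynomials\<close>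

context complete_padic_field
begin

lemma uniformly_differentiable_poly: "uniformly_differentiable (poly q)"
  unfolding uniformly_differentiable_def
proof (rule ballI, rule exI, rule allI, rule impI)
  fix a and \<epsilon> :: real
  assume a: "a \<in> Zp" and \<epsilon>: "\<epsilon> > 0"
  obtain C where C: "0 \<le> C"
    "\<And>x y a. absv x \<le> 1 \<Longrightarrow> absv y \<le> 1 \<Longrightarrow> absv a \<le> 1 \<Longrightarrow>
      absv (poly q x - poly q y - (x - y) * poly (pderiv q) a)
        \<le> C * (absv (x - y) * (absv (x - a) + absv (y - a)))"
    using poly_strict_derivative_unit_ball by blast
  \<comment> \<open>The factor 2 accounts for the two distances to a; C + 1 instead of C avoids
    dividing by 0 and yields a strict inequality.\<close>
  define \<delta> where "\<delta> = \<epsilon> / (2 * (C + 1))"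
  have \<delta>: "\<delta> > 0"
    using C(1) \<epsilon> by (simp add: \<delta>_def)
  have "absv ((poly q x - poly q y) / (x - y) - poly (pderiv q) a) < \<epsilon>"
    if "x \<in> Zp" "y \<in> Zp" and xy: "x \<noteq> y" and d: "absv (x - a) < \<delta>" "absv (y - a) < \<delta>" for x y
  proof -
    let ?t = "(poly q x - poly q y) / (x - y) - poly (pderiv q) a"
    have pos: "absv (x - y) > 0"
      using xy absv_nonneg[of "x - y"] absv_eq_0_iff[of "x - y"] by simp
    have "(x - y) * ?t = poly q x - poly q y - (x - y) * poly (pderiv q) a"
      using xy by (simp add: field_simps)
    then have "absv (x - y) * absv ?t \<le> absv (x - y) * (C * (absv (x - a) + absv (y - a)))"
      using C(2)[of x y a] that a unfolding Zp_def by (simp add: absv_mult[symmetric] mult.left_commute)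
    then have "absv ?t \<le> C * (absv (x - a) + absv (y - a))"
      using pos by simp
    also have "\<dots> \<le> C * (2 * \<delta>)"
      using d C(1) by (intro mult_left_mono) auto
    also have "\<dots> < (C + 1) * (2 * \<delta>)"
      using \<delta> by (simp add: algebra_simps)
    also have "\<dots> = \<epsilon>"
      using C(1) by (simp add: \<delta>_def field_simps)
    finally show ?thesis .
  qed
  with \<delta> show "\<exists>\<delta>>0. \<forall>x\<in>Zp. \<forall>y\<in>Zp. x \<noteq> y \<and> absv (x - a) < \<delta> \<and> absv (y - a) < \<delta> \<longrightarrow>
      absv ((poly q x - poly q y) / (x - y) - poly (pderiv q) a) < \<epsilon>"
    by blast
qed

text \<open>The absolute value of \<open>p ^ N\<close> is \<open>(1 / real p) ^ N\<close>, which
  tends to 0, and the Lipschitz bound carries this over to the values of q.\<close>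

lemma limitin_poly_prime_power:
  "limitin mtopology (\<lambda>N. poly q (of_nat (p ^ N))) (poly q 0) sequentially"
proof -
  obtain C where C: "0 \<le> C"
    "\<And>x y. absv x \<le> 1 \<Longrightarrow> absv y \<le> 1 \<Longrightarrow> absv (poly q x - poly q y) \<le> C * absv (x - y)"
    using poly_lipschitz_unit_ball by blast
  have p: "real p > 1"
    using prime_gt_1_nat[OF prime_p] by simp
  have absv_pN: "absv (of_nat (p ^ N)) = (1 / real p) ^ N" for N
    by (simp add: absv_power absv_p)
  have "(\<lambda>N. C * (1 / real p) ^ N) \<longlonglongrightarrow> C * 0"
    using p by (intro tendsto_intros LIMSEQ_power_zero) auto
  then have "eventually (\<lambda>N. C * (1 / real p) ^ N < e) sequentially" if "e > 0" for e
    using order_tendstoD(2) that by fastforce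
  moreover have "absv (poly q (of_nat (p ^ N)) - poly q 0) \<le> C * (1 / real p) ^ N" for N
  proof -
    have "absv (of_nat (p ^ N)) \<le> 1"
      unfolding absv_pN using p by (intro power_le_one) auto
    then show ?thesis
      using C(2)[of "of_nat (p ^ N)" 0] absv_pN by simp
  qed
  ultimately show ?thesis
    unfolding limit_metric_sequentially eventually_sequentially
    by (meson UNIV_I order_le_less_trans)
qed

text \<open>Treating a whole combination of monomials at once, with free exponents, replaces a
  separate proof that the integral is linear.\<close>

lemma has_volkenborn_integral_sum_powers:
  "has_volkenborn_integral (\<lambda>x. \<Sum>i\<in>A. a i * x ^ e i) (\<Sum>i\<in>A. a i * of_rat (bernoulli (e i)))"
proof -
  let ?f = "\<lambda>x. \<Sum>i\<in>A. a i * x ^ e i"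
  have "\<forall>m. \<exists>q :: 'a poly. poly q 0 = of_rat (bernoulli m) \<and>
      (\<forall>M. (\<Sum>x<M. of_nat x ^ m) = of_nat M * poly q (of_nat M))"
    using sum_powers_polynomial[where 'a = 'a] by metis
  then obtain Q :: "nat \<Rightarrow> 'a poly" where Q: "\<And>m. poly (Q m) 0 = of_rat (bernoulli m)"
    "\<And>m M. (\<Sum>x<M. of_nat x ^ m) = of_nat M * poly (Q m) (of_nat M)"
    by metis
  \<comment> \<open>The N-th Riemann sum is the value of \<open>?R\<close> at \<open>p ^ N\<close>,
    so the integral is its value at 0.\<close>
  let ?R = "\<Sum>i\<in>A. smult (a i) (Q (e i))"
  have "?f = poly (\<Sum>i\<in>A. monom (a i) (e i))"
    by (simp add: fun_eq_iff poly_sum poly_monom)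
  then have "uniformly_differentiable ?f"
    using uniformly_differentiable_poly by metis
  moreover have "1 / of_nat (p ^ N) * (\<Sum>x<p ^ N. ?f (of_nat x)) = poly ?R (of_nat (p ^ N))" for N
  proof -
    have "(\<Sum>x<p ^ N. ?f (of_nat x)) = (\<Sum>i\<in>A. a i * (\<Sum>x<p ^ N. of_nat x ^ e i))"
      by (subst sum.swap) (simp add: sum_distrib_left)
    also have "\<dots> = of_nat (p ^ N) * poly ?R (of_nat (p ^ N))"
      unfolding Q(2) by (simp add: poly_sum sum_distrib_left mult.left_commute)
    finally show ?thesis
      using prime_gt_0_nat[OF prime_p] by simp
  qed
  moreover have "poly ?R 0 = (\<Sum>i\<in>A. a i * of_rat (bernoulli (e i)))"
    by (simp add: poly_sum Q(1))
  ultimately show ?thesis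
    unfolding has_volkenborn_integral_def using limitin_poly_prime_power[of ?R] by simp
qed

end

section \<open>Products of Bernstein polynomials and their integral\<close>

lemma prod_bernstein_power:
  assumes "finite A" and "\<And>i. i \<in> A \<Longrightarrow> k i \<le> n i"
  shows "(\<Prod>i\<in>A. bernstein (k i) (n i) x ^ m i) =
    (\<Prod>i\<in>A. of_nat (n i choose k i) ^ m i) * x ^ (\<Sum>i\<in>A. k i * m i) *
    (1 - x) ^ ((\<Sum>i\<in>A. n i * m i) - (\<Sum>i\<in>A. k i * m i))"
proof -
  \<comment> \<open>The bounds \<open>k i \<le> n i\<close> let truncated subtraction commute with
    the sum.\<close>
  have "(\<Sum>i\<in>A. n i * m i) - (\<Sum>i\<in>A. k i * m i) = (\<Sum>i\<in>A. (n i - k i) * m i)"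
    using assms by (simp add: sum_subtractf_nat diff_mult_distrib)
  then show ?thesis
    by (simp add: bernstein_def power_mult_distrib prod.distrib power_sum power_mult)
qed

lemma one_minus_power_expand:
  "(1 - x :: 'a::comm_ring_1) ^ D = (\<Sum>l=0..D. (- 1) ^ l * of_nat (D choose l) * x ^ l)"
proof -
  have "(1 - x) ^ D = (- x + 1) ^ D"
    by simp
  also have "\<dots> = (\<Sum>l=0..D. (- 1) ^ l * of_nat (D choose l) * x ^ l)"
    unfolding binomial_ring atLeast0AtMost
    by (rule sum.cong) (simp_all add: power_minus[of x] mult_ac)
  finally show ?thesis .
qed

theorem mainTheorem6:
  fixes p s :: nat
    and absv :: "'a::field_char_0 \<Rightarrow> real"
    and k n m :: "nat \<Rightarrow> nat"
    and K D :: nat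
  assumes "prime p"
    and "padic_complex_field absv p"
    and "\<And>i. i \<in> {1..s} \<Longrightarrow> m i > 0"
    and "\<And>i. i \<in> {1..s} \<Longrightarrow> k i \<le> n i"
    and "K = (\<Sum>i=1..s. k i * m i)"
    and "D = (\<Sum>i=1..s. n i * m i) - K"
  shows "complete_padic_field.volkenborn_integrable absv p
           (\<lambda>x. \<Prod>i=1..s. bernstein (k i) (n i) x ^ m i) \<and>
         complete_padic_field.volkenborn_integral absv p
           (\<lambda>x. \<Prod>i=1..s. bernstein (k i) (n i) x ^ m i) =
         (\<Prod>i=1..s. of_nat (n i choose k i) ^ m i) *
         (\<Sum>l=0..D. (- 1) ^ l * of_nat (D choose l) * of_rat (bernoulli (K + l)))"
proof -
  interpret padic_complex_field absv p
    by fact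
  define c :: 'a where "c = (\<Prod>i=1..s. of_nat (n i choose k i) ^ m i)"
  \<comment> \<open>Absorbing c into the coefficients gives the integrand the shape required by
    \<open>has_volkenborn_integral_sum_powers\<close>, with exponents K + l.\<close>
  define b :: "nat \<Rightarrow> 'a" where "b l = c * ((- 1) ^ l * of_nat (D choose l))" for l
  let ?f = "\<lambda>x::'a. \<Prod>i=1..s. bernstein (k i) (n i) x ^ m i"
  have "?f x = c * x ^ K * (1 - x) ^ D" for x
    using prod_bernstein_power[of "{1..s}" k n x m] assms(4-6) by (simp add: c_def)
  then have "?f = (\<lambda>x. \<Sum>l=0..D. b l * x ^ (K + l))"
    by (simp add: fun_eq_iff one_minus_power_expand b_def sum_distrib_left power_add mult_ac)
  then have "has_volkenborn_integral ?f (\<Sum>l=0..D. b l * of_rat (bernoulli (K + l)))"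
    by (simp only: has_volkenborn_integral_sum_powers)
  also have "(\<Sum>l=0..D. b l * of_rat (bernoulli (K + l)))
      = c * (\<Sum>l=0..D. (- 1) ^ l * of_nat (D choose l) * of_rat (bernoulli (K + l)))"
    by (simp add: b_def sum_distrib_left mult.assoc)
  finally show ?thesis
    unfolding c_def volkenborn_integrable_def using volkenborn_integral_eq by blast
qed

end
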